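(* Let $X$ be a graph and let $n\geq 2$. Every subgraph $\Gamma$ of $X$ with exactly $n$ vertices has Cheeger constant $h(\Gamma)\le 4\,\mathrm{sep}_X(n)/n$.
   Context: For a finite graph $\Gamma$ with $n\ge 2$ vertices and $A\subseteq V(\Gamma)$, the vertex boundary $\partial A$ is the set of vertices of $V(\Gamma)\setminus A$ having a neighbour in $A$, and the (vertex) Cheeger constant is $h(\Gamma)=\min\{|\partial A|/|A| : \emptyset\neq A\subseteq V(\Gamma),\ |A|\le n/2\}$. For a finite graph $\Gamma$ with $n$ vertices, the cut size $\mathrm{cut}(\Gamma)$ is the minimal cardinality of a set $S$ of vertices such that every connected component of $\Gamma\setminus S$ has at most $n/2$ vertices. The separation profile of a graph $X$ is the function $\mathrm{sep}_X$ on $\mathbb{N}$ where $\mathrm{sep}_X(n)$ is the maximum of $\mathrm{cut}(\Gamma)$ over all subgraphs $\Gamma$ of $X$ with at most $n$ vertices. *)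

theory Defs
  imports Complex_Main "Graph_Theory.Graph_Theory"
begin

text \<open>
  Undirected simple graphs are symmetric digraphs without loops and parallel arcs. The library locale
  \<^locale>\<open>graph\<close> also demands finiteness; the following one allows infinitely many vertices.
\<close>

locale simple_graph = sym_digraph + loopfree_digraph + nomulti_digraph

text \<open>
  The library's \<^const>\<open>subgraph\<close> is the relation on digraphs, so a subgraph of a symmetric digraph
  may fail to be symmetric; requiring \<^locale>\<open>graph\<close> restores this. Subgraphs need not be induced.
\<close>

definition finite_subgraph :: "('a, 'b) pre_digraph \<Rightarrow> ('a, 'b) pre_digraph \<Rightarrow> bool" where
  "finite_subgraph H X \<longleftrightarrow> graph H \<and> subgraph H X"

definition vertex_boundary :: "('a, 'b) pre_digraph \<Rightarrow> 'a set \<Rightarrow> 'a set" where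
  "vertex_boundary G A = {v \<in> verts G - A. \<exists>u \<in> A. v \<rightarrow>\<^bsub>G\<^esub> u}"

definition cheeger :: "('a, 'b) pre_digraph \<Rightarrow> real" where
  "cheeger G = Min {real (card (vertex_boundary G A)) / real (card A) | A.
     A \<noteq> {} \<and> A \<subseteq> verts G \<and> real (card A) \<le> real (card (verts G)) / 2}"

definition connected_component :: "('a, 'b) pre_digraph \<Rightarrow> ('a, 'b) pre_digraph \<Rightarrow> bool" where
  "connected_component G C \<longleftrightarrow> pre_digraph.max_subgraph G connected C"

definition cut_set :: "('a, 'b) pre_digraph \<Rightarrow> 'a set \<Rightarrow> bool" where
  "cut_set G S \<longleftrightarrow> S \<subseteq> verts G \<and>
     (\<forall>C. connected_component (G \<restriction> (verts G - S)) C \<longrightarrow>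
        real (card (verts C)) \<le> real (card (verts G)) / 2)"

definition cut_size :: "('a, 'b) pre_digraph \<Rightarrow> nat" where
  "cut_size G = Min {card S | S. cut_set G S}"

definition sep :: "('a, 'b) pre_digraph \<Rightarrow> nat \<Rightarrow> nat" where
  "sep X n = Max {cut_size H | H. finite_subgraph H X \<and> card (verts H) \<le> n}"

text \<open>
  Minima and maxima of infinite or empty sets are unspecified, so we record that the sets above are
  finite and nonempty.
\<close>

lemma cheeger_set:
  assumes "finite (verts G)" "card (verts G) \<ge> 2"
  defines "R \<equiv> {real (card (vertex_boundary G A)) / real (card A) | A.
     A \<noteq> {} \<and> A \<subseteq> verts G \<and> real (card A) \<le> real (card (verts G)) / 2}"
  shows "finite R" "R \<noteq> {}"
proof -
  have "R \<subseteq> (\<lambda>A. real (card (vertex_boundary G A)) / real (card A)) ` Pow (verts G)"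
    unfolding R_def by blast
  then show "finite R" by (rule finite_subset) (use assms in simp)
  have "verts G \<noteq> {}" using assms(2) by (metis card.empty not_numeral_le_zero)
  then obtain v where v: "v \<in> verts G" by blast
  have "real (card {v}) \<le> real (card (verts G)) / 2" using assms(2) by simp
  with v have "real (card (vertex_boundary G {v})) / real (card {v}) \<in> R"
    unfolding R_def by (intro CollectI exI[of _ "{v}"]) simp
  then show "R \<noteq> {}" by blast
qed

lemma cut_set_verts: "cut_set G (verts G)"
proof -
  have "verts C = {}" if "connected_component (G \<restriction> {}) C" for C
  proof -
    have "verts C \<subseteq> verts (G \<restriction> {})"
      using that unfolding connected_component_def pre_digraph.max_subgraph_def subgraph_def
      by (elim conjE)
    then show ?thesis by simp
  qed
  then show ?thesis by (simp add: cut_set_def)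
qed

lemma cut_set_finite:
  assumes "finite (verts G)"
  shows "finite {card S | S. cut_set G S}" "{card S | S. cut_set G S} \<noteq> {}"
proof -
  have "{card S | S. cut_set G S} \<subseteq> card ` Pow (verts G)"
    unfolding cut_set_def by blast
  then show "finite {card S | S. cut_set G S}"
    by (rule finite_subset) (use assms in simp)
  show "{card S | S. cut_set G S} \<noteq> {}" using cut_set_verts[of G] by blast
qed

lemma cut_size_le:
  assumes "finite (verts G)"
  shows "cut_size G \<le> card (verts G)"
proof -
  have "card (verts G) \<in> {card S | S. cut_set G S}" using cut_set_verts[of G] by blast
  then show ?thesis unfolding cut_size_def by (rule Min_le[OF cut_set_finite(1)[OF assms]])
qed

lemma sep_set:
  fixes X :: "('a, 'b) pre_digraph"
  assumes "simple_graph X"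
  defines "R \<equiv> \<lambda>n. {cut_size H | H. finite_subgraph H X \<and> card (verts H) \<le> n}"
  shows "finite (R n)" "R n \<noteq> {}"
proof -
  have "cut_size H \<le> n" if "finite_subgraph H X" "card (verts H) \<le> n" for H
  proof -
    interpret graph H using that(1) by (simp add: finite_subgraph_def)
    show ?thesis using cut_size_le[of H] that(2) by simp
  qed
  then have "R n \<subseteq> {..n}" unfolding R_def by blast
  then show "finite (R n)" by (rule finite_subset) simp
  let ?E = "\<lparr>verts = {}, arcs = {}, tail = tail X, head = head X\<rparr> :: ('a, 'b) pre_digraph"
  interpret X: simple_graph X by (rule assms(1))
  have E: "graph ?E"
    by unfold_locales (simp_all add: symmetric_def arcs_ends_def sym_def)
  interpret E: graph ?E by (rule E)
  have "subgraph ?E X"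
    unfolding subgraph_def compatible_def
    by (simp add: X.wf_digraph_axioms E.wf_digraph_axioms)
  with E have "cut_size ?E \<in> R n"
    unfolding R_def finite_subgraph_def by (intro CollectI exI[of _ ?E]) simp
  then show "R n \<noteq> {}" by blast
qed

end

theory Submission
  imports Defs
begin

text \<open>
  Let \<open>S\<close> be a minimum cut set of \<open>\<Gamma>\<close>, with \<open>s\<close> elements. If \<open>s \<le> 3n/4\<close>, the components of
  \<open>\<Gamma> \<setminus> S\<close> have at least \<open>n/4\<close> vertices altogether and at most \<open>n/2\<close> each, so some union \<open>A\<close> of
  components satisfies \<open>n/4 \<le> |A| \<le> n/2\<close>; its boundary lies in \<open>S\<close>, and \<open>|\<partial>A|/|A| \<le> 4s/n\<close>.
  If \<open>s > 3n/4\<close>, any set \<open>A\<close> of \<open>\<lfloor>n/2\<rfloor>\<close> vertices has \<open>|\<partial>A|/|A| \<le> 2 < 4s/n\<close>.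
\<close>

text \<open>Induction on \<open>F\<close>: if neither the new value nor the remaining sum reaches
  \<open>m\<close>, the total, at least \<open>m\<close> by assumption, stays below
  \<open>2 * m\<close> and the whole set serves. Otherwise the new element alone or the induction
  hypothesis does.\<close>

lemma exists_subset_sum_between:
  fixes f :: "'c \<Rightarrow> real"
  assumes "finite F" "\<And>x. x \<in> F \<Longrightarrow> f x \<le> 2 * m" "m \<le> sum f F" "0 \<le> m"
  shows "\<exists>F' \<subseteq> F. m \<le> sum f F' \<and> sum f F' \<le> 2 * m"
  using assms(1-3)
proof (induction F rule: finite_induct)
  case empty
  then show ?case using assms(4) by auto
next
  case (insert x F)
  consider "m \<le> f x" | "m \<le> sum f F" | "f x < m" "sum f F < m" by linarith
  then show ?case
  proof cases
    case 1
    then show ?thesis using insert.prems(1)[of x] by (intro exI[of _ "{x}"]) auto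
  next
    case 2
    then show ?thesis using insert.IH insert.prems(1) by blast
  next
    case 3
    then show ?thesis using insert by (intro exI[of _ "insert x F"]) auto
  qed
qed

lemma cheeger_le:
  assumes "finite (verts G)" "A \<noteq> {}" "A \<subseteq> verts G" "real (card A) \<le> real (card (verts G)) / 2"
  shows "cheeger G \<le> real (card (vertex_boundary G A)) / real (card A)"
proof -
  have "0 < card A" using assms(1-3) by (simp add: card_gt_0_iff finite_subset)
  \<comment> \<open>A nonempty set filling at most half of the vertices forces two vertices, as
    \<open>cheeger_set\<close> requires.\<close>
  then have "2 \<le> card (verts G)" using assms(4) by linarith
  from cheeger_set(1)[OF assms(1) this] show ?thesis
    unfolding cheeger_def by (rule Min_le) (use assms in blast)
qed

lemma cut_size_witness:
  assumes "finite (verts G)"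
  obtains S where "cut_set G S" "card S = cut_size G"
  using Min_in[OF cut_set_finite[OF assms]] unfolding cut_size_def by auto

lemma cut_size_le_sep:
  assumes "simple_graph X" "finite_subgraph H X" "card (verts H) \<le> n"
  shows "cut_size H \<le> sep X n"
  unfolding sep_def by (rule Max_ge[OF sep_set(1)[OF assms(1)]]) (use assms in blast)

lemma subgraph_antisym:
  assumes "subgraph G H" "subgraph H G"
  shows "G = H"
  using assms by (auto simp: subgraph_def compatible_def intro: pre_digraph.equality)

text \<open>Bridges the library's strong components, which partition the vertices, and the maximal
  connected subgraphs that \<open>cut_set\<close> quantifies over: with symmetric arcs, connected
  induced subgraphs are strongly connected.\<close>

lemma (in sym_digraph) sccs_connected_component:
  assumes "C \<in> sccs"
  shows "connected_component G C"
  unfolding connected_component_def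
proof (rule max_subgraphI)
  have max: "max_subgraph strongly_connected C" using assms by (simp add: sccs_altdef2)
  then show sub: "subgraph C G" by (rule subgraphI_max_subgraph)
  interpret C: wf_digraph C using sub by blast
  have sc: "strongly_connected C" using max by (rule max_subgraph_prop)
  show "connected C"
    using sc by (intro C.connectedI) (auto simp: strongly_connected_def intro: C.reachable_mk_symmetricI)
  fix H
  assume H: "C \<noteq> H" "subgraph C H" "subgraph H G"
  show "\<not> connected H"
  proof
    assume conn: "connected H"
    \<comment> \<open>\<open>H\<close> may lack reverse arcs; symmetry is recovered by passing to
      the induced subgraph on its vertices.\<close>
    let ?K = "G \<restriction> verts H"
    have HK: "subgraph H ?K" using H(3) by (rule subgraph_induce_subgraphI2)
    have ind: "induced_subgraph ?K G" using H(3) by blast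
    interpret K: wf_digraph ?K by (rule wellformed_induce_subgraph)
    have "connected ?K"
      using HK by (intro K.connected_spanning_imp_connected[OF _ conn]) (simp add: spanning_def)
    then have "strongly_connected ?K"
      by (rule K.symmetric_connected_imp_strongly_connected
          [OF induced_graph_imp_symmetric[OF sym_arcs ind]])
    moreover have "subgraph C ?K" "subgraph ?K G"
      using subgraph_trans[OF H(2) HK] ind by auto
    ultimately have "C = ?K" using max unfolding max_subgraph_def by metis
    \<comment> \<open>\<open>H\<close> lies between \<open>C\<close> and \<open>?K\<close>, so the
      equality forces \<open>H = C\<close>.\<close>
    then show False using H(1,2) HK subgraph_antisym by blast
  qed
qed

text \<open>A boundary vertex outside \<open>S\<close> would be joined to a component in
  \<open>F\<close> by an edge surviving the deletion of \<open>S\<close>, and so would belong to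
  that component.\<close>

lemma vertex_boundary_Union_sccs_verts:
  fixes G :: "('a, 'b) pre_digraph"
  assumes "sym_digraph G" and F: "F \<subseteq> pre_digraph.sccs_verts (G \<restriction> (verts G - S))"
  shows "vertex_boundary G (\<Union>F) \<subseteq> S"
proof
  interpret sym_digraph G by fact
  let ?H = "G \<restriction> (verts G - S)"
  interpret H: sym_digraph ?H by (rule induced_graph_imp_graph) blast
  fix v assume "v \<in> vertex_boundary G (\<Union>F)"
  then obtain u c where v: "v \<in> verts G" "v \<notin> \<Union>F" and u: "u \<in> c" "c \<in> F" and adj: "v \<rightarrow>\<^bsub>G\<^esub> u"
    unfolding vertex_boundary_def by blast
  have c: "c \<in> H.sccs_verts" using F u(2) by blast
  show "v \<in> S"
  proof (rule ccontr)
    assume "v \<notin> S"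
    moreover have "u \<in> verts G - S" using H.sccs_verts_subsets[OF c] u(1) by auto
    ultimately have "v \<rightarrow>\<^bsub>?H\<^esub> u" using adj v(1) by (auto simp: arcs_ends_conv)
    then have vu: "v \<rightarrow>\<^sup>*\<^bsub>?H\<^esub> u" by (rule H.reachable_adjI)
    \<comment> \<open>Sharing a strong component takes paths both ways; symmetry gives the return
      path.\<close>
    then have "u \<rightarrow>\<^sup>*\<^bsub>?H\<^esub> v" by (rule symmetric_reachable[OF H.sym_arcs])
    with vu have "v \<in> c" using c u(1) unfolding H.in_sccs_verts_conv_reachable by blast
    with u(2) v(2) show False by blast
  qed
qed

lemma cut_set_balanced:
  fixes G :: "('a, 'b) pre_digraph"
  assumes "graph G" "cut_set G S" "real (card S) \<le> 3 * real (card (verts G)) / 4"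
  obtains A where "A \<subseteq> verts G" "real (card (verts G)) / 4 \<le> real (card A)"
    "real (card A) \<le> real (card (verts G)) / 2" "vertex_boundary G A \<subseteq> S"
proof -
  interpret graph G by fact
  let ?H = "G \<restriction> (verts G - S)" and ?n = "real (card (verts G))"
  have ind: "induced_subgraph ?H G" by blast
  interpret H: sym_digraph ?H by (rule induced_graph_imp_graph[OF ind])
  interpret H: digraph ?H by (rule digraphI_induced[OF ind])
  have S: "S \<subseteq> verts G" using assms(2) by (simp add: cut_set_def)
  have fin: "finite c" if "c \<in> H.sccs_verts" for c
    using H.sccs_verts_subsets[OF that] H.finite_verts by (rule finite_subset)
  have card_Union: "card (\<Union>F) = sum card F" if "F \<subseteq> H.sccs_verts" for F
  proof (rule card_Union_disjoint)
    show "pairwise disjnt F"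
      unfolding pairwise_def disjnt_def using that H.sccs_verts_disjoint by blast
    show "\<And>c. c \<in> F \<Longrightarrow> finite c" using that fin by blast
  qed
  have "\<Union>H.sccs_verts = verts G - S"
    using H.sccs_verts_subsets H.scc_of_in_sccs_verts H.in_scc_of_self by fastforce
  then have "sum card H.sccs_verts = card (verts G) - card S"
    using card_Union[of H.sccs_verts] S by (simp add: card_Diff_subset finite_subset)
  \<comment> \<open>The bound on \<open>card S\<close> leaves at least n - 3n/4 vertices.\<close>
  then have "?n / 4 \<le> real (sum card H.sccs_verts)" using assms(3) by simp
  moreover have "real (card c) \<le> 2 * (?n / 4)" if "c \<in> H.sccs_verts" for c
  proof -
    have "connected_component ?H (?H \<restriction> c)"
      by (rule H.sccs_connected_component[OF H.in_verts_sccsD_sccs[OF that]])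
    then show ?thesis using assms(2) by (fastforce simp: cut_set_def)
  qed
  \<comment> \<open>With m = n/4, the cap 2m on each component is the n/2 of the cut
    condition.\<close>
  ultimately obtain F where F: "F \<subseteq> H.sccs_verts"
    "?n / 4 \<le> (\<Sum>c\<in>F. real (card c))" "(\<Sum>c\<in>F. real (card c)) \<le> 2 * (?n / 4)"
    using exists_subset_sum_between[OF H.finite_sccs_verts, of "\<lambda>c. real (card c)" "?n / 4"]
    by auto
  show thesis
  proof (rule that)
    show "\<Union>F \<subseteq> verts G" using F(1) H.sccs_verts_subsets by fastforce
    show "?n / 4 \<le> real (card (\<Union>F))" "real (card (\<Union>F)) \<le> ?n / 2"
      using F card_Union by simp_all
    show "vertex_boundary G (\<Union>F) \<subseteq> S"
      using F(1) by (rule vertex_boundary_Union_sccs_verts[OF sym_digraph_axioms])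
  qed
qed

lemma cheeger_le_2:
  assumes "finite (verts G)" "2 \<le> card (verts G)"
  shows "cheeger G \<le> 2"
proof -
  let ?n = "card (verts G)"
  obtain A where A: "A \<subseteq> verts G" "card A = ?n div 2" "finite A"
    by (rule obtain_subset_with_card_n[of "?n div 2" "verts G"]) auto
  have pos: "0 < card A" using A(2) assms(2) by linarith
  have "cheeger G \<le> real (card (vertex_boundary G A)) / real (card A)"
    using A pos by (intro cheeger_le[OF assms(1)]) auto
  also have "vertex_boundary G A \<subseteq> verts G - A" by (auto simp: vertex_boundary_def)
  then have "card (vertex_boundary G A) \<le> card (verts G - A)"
    using assms(1) by (intro card_mono) auto
  \<comment> \<open>For n \<ge> 2, n - n div 2 \<le> 2 (n div 2), with equality at n = 3.\<close>
  then have "card (vertex_boundary G A) \<le> 2 * card A"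
    using A assms(2) by (simp add: card_Diff_subset)
  then have "real (card (vertex_boundary G A)) / real (card A) \<le> 2"
    using pos by (simp add: divide_le_eq)
  finally show ?thesis .
qed

lemma cheeger_le_cut_size:
  fixes G :: "('a, 'b) pre_digraph"
  assumes "graph G" "2 \<le> card (verts G)"
  shows "cheeger G \<le> 4 * real (cut_size G) / real (card (verts G))"
proof -
  interpret graph G by fact
  let ?n = "real (card (verts G))"
  have n: "0 < ?n" using assms(2) by simp
  obtain S where S: "cut_set G S" "card S = cut_size G"
    by (rule cut_size_witness[OF finite_verts])
  show ?thesis
  proof (cases "real (card S) \<le> 3 * ?n / 4")
    case True
    obtain A where A: "A \<subseteq> verts G" "?n / 4 \<le> real (card A)" "real (card A) \<le> ?n / 2"
      "vertex_boundary G A \<subseteq> S"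
      by (rule cut_set_balanced[OF assms(1) S(1) True])
    have "finite S" using S(1) by (auto simp: cut_set_def intro: finite_subset)
    then have le: "real (card (vertex_boundary G A)) \<le> real (card S)"
      using A(4) by (simp add: card_mono)
    have "A \<noteq> {}" using A(2) n by auto
    then have "cheeger G \<le> real (card (vertex_boundary G A)) / real (card A)"
      using A by (intro cheeger_le) auto
    \<comment> \<open>Replacing |A| by its lower bound n/4 produces the factor 4.\<close>
    also have "\<dots> \<le> real (card S) / (?n / 4)"
      using le A(2) n by (intro frac_le) auto
    finally show ?thesis by (simp add: S(2) mult.commute)
  next
    case False
    then have "2 \<le> 4 * real (cut_size G) / ?n"
      using n by (simp add: S(2) le_divide_eq)
    with cheeger_le_2[OF finite_verts assms(2)] show ?thesis by (rule order_trans)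
  qed
qed

theorem theorem1p4:
  fixes X \<Gamma> :: "('a, 'b) pre_digraph" and n :: nat
  assumes "simple_graph X"
    and "n \<ge> 2"
    and "finite_subgraph \<Gamma> X"
    and "card (verts \<Gamma>) = n"
  shows "cheeger \<Gamma> \<le> 4 * real (sep X n) / real n"
proof -
  have "cheeger \<Gamma> \<le> 4 * real (cut_size \<Gamma>) / real n"
    using cheeger_le_cut_size[of \<Gamma>] assms by (simp add: finite_subgraph_def)
  \<comment> \<open>\<Gamma> itself is among the subgraphs over which \<open>sep X n\<close> is the
    maximum.\<close>
  also have "\<dots> \<le> 4 * real (sep X n) / real n"
    using cut_size_le_sep[OF assms(1,3)] assms(4) by (simp add: divide_right_mono)
  finally show ?thesis .
qed

end
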